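(* Let $q$ be a prime power and for $n\geq 1$ let $d_n$ be the number of $n \times n$ matrices over $\mathbf{F}_q$ that are diagonalizable over $\mathbf{F}_q$. Then $$1 + \sum_{n \geq 1}\frac{d_n}{\gamma_n}u^n = \left( \sum_{m\geq 0} \frac{u^m}{\gamma_m} \right)^q$$ and, for every $n\geq 1$, $$d_n = \sum_{n_1 + \cdots + n_q = n} \frac{\gamma_n}{\gamma_{n_1}\cdots\gamma_{n_q}},$$ where the sum is over all $q$-tuples $(n_1,\ldots,n_q)$ of non-negative integers with $n_1+\cdots+n_q=n$.
   Context: $\mathbf{F}_q$ is the field with $q$ elements. $\gamma_n=|\mathrm{GL}_n(q)|=(q^n-1)(q^n-q)\cdots(q^n-q^{n-1})$ is the order of the group of invertible $n\times n$ matrices over $\mathbf{F}_q$, with $\gamma_0=1$. The generating function identity is one of formal power series in $u$. *)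

theory Defs
  imports
    "Jordan_Normal_Form.Matrix"
    "HOL-Computational_Algebra.Formal_Power_Series"
    "HOL-Number_Theory.Prime_Powers"
begin

definition GL_mat :: "nat \<Rightarrow> 'a::field mat set" where
  "GL_mat n = {A \<in> carrier_mat n n. invertible_mat A}"

definition diagonalizable_mat :: "'a::field mat \<Rightarrow> bool" where
  "diagonalizable_mat A \<longleftrightarrow> (\<exists>D. diagonal_mat D \<and> similar_mat A D)"

definition gl_order :: "'a::{field,finite} itself \<Rightarrow> nat \<Rightarrow> nat" where
  "gl_order _ n = card (GL_mat n :: 'a mat set)"

definition num_diagonalizable :: "'a::{field,finite} itself \<Rightarrow> nat \<Rightarrow> nat" where
  "num_diagonalizable _ n = card {A :: 'a mat. A \<in> carrier_mat n n \<and> diagonalizable_mat A}"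

text \<open>\<^const>\<open>card\<close> is \<open>0\<close> on infinite sets; over a finite field the sets counted above are finite.\<close>

lemma finite_carrier_mat: "finite (carrier_mat m n :: 'a::finite mat set)"
proof -
  let ?I = "{0..<m} \<times> {0..<n}"
  have "finite {f. \<forall>x. (x \<in> ?I \<longrightarrow> f x \<in> (UNIV :: 'a set)) \<and> (x \<notin> ?I \<longrightarrow> f x = undefined)}"
    by (intro finite_set_of_finite_funs) auto
  moreover have "carrier_mat m n \<subseteq> mat m n `
      {f. \<forall>x. (x \<in> ?I \<longrightarrow> f x \<in> (UNIV :: 'a set)) \<and> (x \<notin> ?I \<longrightarrow> f x = undefined)}"
  proof
    fix A :: "'a mat" assume A: "A \<in> carrier_mat m n"
    let ?f = "\<lambda>x. if x \<in> ?I then A $$ x else undefined"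
    have "A = mat m n ?f" using A by (intro eq_matI) auto
    then show "A \<in> mat m n `
      {f. \<forall>x. (x \<in> ?I \<longrightarrow> f x \<in> (UNIV :: 'a set)) \<and> (x \<notin> ?I \<longrightarrow> f x = undefined)}"
      by (intro image_eqI[where x = ?f]) auto
  qed
  ultimately show ?thesis by (meson finite_imageI finite_subset)
qed

lemma gl_order_0: "gl_order TYPE('a::{field,finite}) 0 = 1"
proof -
  have "GL_mat 0 = {1\<^sub>m 0 :: 'a mat}"
    by (auto simp: GL_mat_def invertible_mat_def inverts_mat_def intro!: eq_matI exI[of _ "1\<^sub>m 0"])
  then show ?thesis by (simp add: gl_order_def)
qed

end

theory Submission
  imports
    Defs
    "Jordan_Normal_Form.Determinant"
begin

text \<open>
  The group of invertible matrices acts on square matrices by conjugation, and the diagonalizable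
  matrices are the union of the orbits of the diagonal ones. Two diagonal matrices lie in the same
  orbit exactly when their diagonals agree as multisets (lemma \<open>similar_list_diag_iff\<close>), so over a
  field with elements \<open>a\<^sub>1, \<dots>, a\<^sub>q\<close> the orbits correspond to the tuples \<open>(n\<^sub>1, \<dots>, n\<^sub>q)\<close> of
  multiplicities with sum \<open>n\<close>. Choosing as representative the diagonal matrix in which equal entries
  stand next to each other, a matrix commutes with it iff it is block diagonal with blocks of sizes
  \<open>n\<^sub>1, \<dots>, n\<^sub>q\<close>; hence its stabilizer has \<open>\<gamma>\<^bsub>n\<^sub>1\<^esub> \<cdots> \<gamma>\<^bsub>n\<^sub>q\<^esub>\<close> elements
  (lemma \<open>card_centralizer_eigenvalue_list\<close>). By the orbit-stabilizer theorem
  (lemma \<open>card_similarity_class\<close>) the orbit has \<open>\<gamma>\<^sub>n / (\<gamma>\<^bsub>n\<^sub>1\<^esub> \<cdots> \<gamma>\<^bsub>n\<^sub>q\<^esub>)\<close> elements, and adding up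
  the orbits gives the formula for \<open>d\<^sub>n\<close>. Divided by \<open>\<gamma>\<^sub>n\<close>, it says that \<open>d\<^sub>n / \<gamma>\<^sub>n\<close> is a \<open>q\<close>-fold
  convolution, which is the identity of generating functions.
\<close>

section \<open>Invertible matrices and similarity\<close>

lemma GL_mat_iff_inverse:
  "A \<in> GL_mat n \<longleftrightarrow>
    A \<in> carrier_mat n n \<and> (\<exists>B \<in> carrier_mat n n. A * B = 1\<^sub>m n \<and> B * A = 1\<^sub>m n)"
proof
  assume "A \<in> GL_mat n"
  then obtain B where A: "A \<in> carrier_mat n n"
    and B: "A * B = 1\<^sub>m n" "B * A = 1\<^sub>m (dim_row B)"
    by (auto simp: GL_mat_def invertible_mat_def inverts_mat_def)
  have "dim_col B = n" using arg_cong[OF B(1), of dim_col] by simp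
  moreover have "dim_row B = n" using arg_cong[OF B(2), of dim_col] A by simp
  ultimately show "A \<in> carrier_mat n n \<and> (\<exists>B \<in> carrier_mat n n. A * B = 1\<^sub>m n \<and> B * A = 1\<^sub>m n)"
    using A B by (intro conjI bexI[of _ B]) auto
qed (auto simp: GL_mat_def invertible_mat_def inverts_mat_def)

lemma GL_mat_iff_det:
  "A \<in> GL_mat n \<longleftrightarrow> A \<in> carrier_mat n n \<and> det A \<noteq> (0 :: 'a::field)"
proof
  assume "A \<in> GL_mat n"
  then obtain B where A: "A \<in> carrier_mat n n" and B: "B \<in> carrier_mat n n" "A * B = 1\<^sub>m n"
    by (auto simp: GL_mat_iff_inverse)
  have "det A * det B = 1" using det_mult[OF A B(1)] B(2) by simp
  then show "A \<in> carrier_mat n n \<and> det A \<noteq> 0" using A by auto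
next
  assume A: "A \<in> carrier_mat n n \<and> det A \<noteq> 0"
  then have "A \<in> Units (ring_mat TYPE('a) n ())" by (intro det_non_zero_imp_unit) auto
  then show "A \<in> GL_mat n" by (auto simp: GL_mat_iff_inverse Units_def ring_mat_def)
qed

lemma GL_mat_carrier: "A \<in> GL_mat n \<Longrightarrow> A \<in> carrier_mat n n"
  by (simp add: GL_mat_def)

lemma GL_mat_mult: "A \<in> GL_mat n \<Longrightarrow> B \<in> GL_mat n \<Longrightarrow> A * B \<in> GL_mat n"
  by (auto simp: GL_mat_iff_det det_mult)

lemma finite_GL_mat: "finite (GL_mat n :: 'a::{field,finite} mat set)"
  by (rule finite_subset[OF _ finite_carrier_mat[of n n]]) (auto simp: GL_mat_def)

lemma gl_order_pos: "gl_order TYPE('a::{field,finite}) n > 0"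
proof -
  have "(1\<^sub>m n :: 'a mat) \<in> GL_mat n" by (simp add: GL_mat_iff_det)
  then show ?thesis unfolding gl_order_def using finite_GL_mat by (auto simp: card_gt_0_iff)
qed

definition intertwiners :: "nat \<Rightarrow> 'a::field mat \<Rightarrow> 'a mat \<Rightarrow> 'a mat set" where
  "intertwiners n A B = {P \<in> GL_mat n. A * P = P * B}"

lemma finite_intertwiners: "finite (intertwiners n A (B :: 'a::{field,finite} mat))"
  by (rule finite_subset[OF _ finite_GL_mat[of n]]) (auto simp: intertwiners_def)

text \<open>
  Writing similarity as \<open>A P = P B\<close> rather than \<open>A = P B P\<^sup>-\<^sup>1\<close> gives equations that are linear in the
  entries of \<open>P\<close>; for diagonal \<open>A\<close> and \<open>B\<close> they can be solved by inspection.
\<close>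

lemma similar_mat_iff_intertwiners:
  fixes A B :: "'a::field mat"
  assumes A: "A \<in> carrier_mat n n" and B: "B \<in> carrier_mat n n"
  shows "similar_mat A B \<longleftrightarrow> intertwiners n A B \<noteq> {}"
proof
  assume "similar_mat A B"
  then obtain P Q where w: "similar_mat_wit A B P Q" by (auto simp: similar_mat_def)
  note w = similar_mat_witD2[OF A w]
  have "A * P = P * B * (Q * P)" using w by (simp add: assoc_mult_mat[of _ n n _ n _ n])
  then have "A * P = P * B" using w by simp
  moreover have "P \<in> GL_mat n" using w by (auto simp: GL_mat_iff_inverse)
  ultimately show "intertwiners n A B \<noteq> {}" by (auto simp: intertwiners_def)
next
  assume "intertwiners n A B \<noteq> {}"
  then obtain P where P: "P \<in> GL_mat n" "A * P = P * B" by (auto simp: intertwiners_def)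
  then obtain Q where Pc: "P \<in> carrier_mat n n" and Q: "Q \<in> carrier_mat n n"
    "P * Q = 1\<^sub>m n" "Q * P = 1\<^sub>m n" by (auto simp: GL_mat_iff_inverse)
  have "P * B * Q = A * (P * Q)" using A Pc Q P(2)[symmetric] by (simp add: assoc_mult_mat[of _ n n _ n _ n])
  then have "A = P * B * Q" using A Q by simp
  then show "similar_mat A B" using A B Pc Q by (intro similar_matI[of A B P Q n]) auto
qed

text \<open>
  If \<open>P\<close> is one matrix with \<open>A P = P B\<close>, all others are \<open>P M\<close> with \<open>M\<close> commuting with \<open>B\<close>: they form
  a coset of the centralizer of \<open>B\<close>.
\<close>

lemma card_intertwiners:
  fixes A B :: "'a::field mat"
  assumes A: "A \<in> carrier_mat n n" and B: "B \<in> carrier_mat n n" and sim: "similar_mat A B"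
  shows "card (intertwiners n A B) = card (intertwiners n B B)"
proof -
  note assoc = assoc_mult_mat[of _ n n _ n _ n]
  obtain P where P: "P \<in> GL_mat n" "A * P = P * B"
    using sim similar_mat_iff_intertwiners[OF A B] by (auto simp: intertwiners_def)
  then obtain Q where Pc: "P \<in> carrier_mat n n" and Q: "Q \<in> carrier_mat n n"
    "P * Q = 1\<^sub>m n" "Q * P = 1\<^sub>m n" by (auto simp: GL_mat_iff_inverse)
  have QGL: "Q \<in> GL_mat n" using Q Pc by (auto simp: GL_mat_iff_inverse)
  have "Q * A = Q * A * (P * Q)" using A Q by simp
  also have "\<dots> = Q * (A * P) * Q" using A Pc Q(1) by (simp add: assoc)
  also have "\<dots> = (Q * P) * (B * Q)" unfolding P(2) using B Pc Q(1) by (simp add: assoc)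
  finally have QA: "Q * A = B * Q" using B Q by simp
  have "bij_betw (\<lambda>M. P * M) (intertwiners n B B) (intertwiners n A B)"
  proof (rule bij_betwI[where g = "\<lambda>R. Q * R"])
    show "(\<lambda>M. P * M) \<in> intertwiners n B B \<rightarrow> intertwiners n A B"
    proof
      fix M assume "M \<in> intertwiners n B B"
      then have M: "M \<in> GL_mat n" "B * M = M * B" by (auto simp: intertwiners_def)
      note Mc = GL_mat_carrier[OF M(1)]
      have "A * (P * M) = A * P * M" using A Pc Mc by (simp add: assoc)
      also have "\<dots> = P * (B * M)" unfolding P(2) using B Pc Mc by (simp add: assoc)
      also have "\<dots> = P * M * B" unfolding M(2) using B Pc Mc by (simp add: assoc)
      finally show "P * M \<in> intertwiners n A B" using P M by (auto simp: intertwiners_def GL_mat_mult)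
    qed
    show "(\<lambda>R. Q * R) \<in> intertwiners n A B \<rightarrow> intertwiners n B B"
    proof
      fix R assume "R \<in> intertwiners n A B"
      then have R: "R \<in> GL_mat n" "A * R = R * B" by (auto simp: intertwiners_def)
      note Rc = GL_mat_carrier[OF R(1)]
      have "B * (Q * R) = B * Q * R" using B Q(1) Rc by (simp add: assoc)
      also have "\<dots> = Q * (A * R)" unfolding QA[symmetric] using A Q(1) Rc by (simp add: assoc)
      also have "\<dots> = Q * R * B" unfolding R(2) using B Q(1) Rc by (simp add: assoc)
      finally show "Q * R \<in> intertwiners n B B" using QGL R by (auto simp: intertwiners_def GL_mat_mult)
    qed
    show "Q * (P * M) = M" if "M \<in> intertwiners n B B" for M
    proof -
      have M: "M \<in> carrier_mat n n" using that by (auto simp: intertwiners_def GL_mat_carrier)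
      have "Q * (P * M) = Q * P * M" using M Pc Q(1) by (simp add: assoc)
      then show ?thesis using M Q by simp
    qed
    show "P * (Q * R) = R" if "R \<in> intertwiners n A B" for R
    proof -
      have R: "R \<in> carrier_mat n n" using that by (auto simp: intertwiners_def GL_mat_carrier)
      have "P * (Q * R) = P * Q * R" using R Pc Q(1) by (simp add: assoc)
      then show ?thesis using R Q by simp
    qed
  qed
  then show ?thesis by (simp add: bij_betw_same_card)
qed

text \<open>
  The orbit-stabilizer theorem for conjugation: the invertible \<open>P\<close> are sorted by the matrix
  \<open>A = P B P\<^sup>-\<^sup>1\<close> that they produce, and all classes have the size of the centralizer of \<open>B\<close>.
\<close>

lemma card_similarity_class:
  fixes B :: "'a::{field,finite} mat"
  assumes B: "B \<in> carrier_mat n n"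
  shows "card {A \<in> carrier_mat n n. similar_mat A B} * card (intertwiners n B B) = gl_order TYPE('a) n"
proof -
  let ?O = "{A \<in> carrier_mat n n. similar_mat A B}"
  have fin: "finite ?O" by (rule finite_subset[OF _ finite_carrier_mat[of n n]]) auto
  have "GL_mat n \<subseteq> (\<Union>A\<in>?O. intertwiners n A B)"
  proof
    fix P :: "'a mat" assume P: "P \<in> GL_mat n"
    then obtain Q where Pc: "P \<in> carrier_mat n n" and Q: "Q \<in> carrier_mat n n" "Q * P = 1\<^sub>m n"
      by (auto simp: GL_mat_iff_inverse)
    let ?A = "P * B * Q"
    have A: "?A \<in> carrier_mat n n" using Pc B Q by simp
    have "?A * P = P * B * (Q * P)" using Pc B Q(1) by (simp add: assoc_mult_mat[of _ n n _ n _ n])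
    then have "P \<in> intertwiners n ?A B" using P Pc B Q by (simp add: intertwiners_def)
    then show "P \<in> (\<Union>A\<in>?O. intertwiners n A B)"
      using A similar_mat_iff_intertwiners[OF A B] by auto
  qed
  then have GL: "GL_mat n = (\<Union>A\<in>?O. intertwiners n A B)" by (auto simp: intertwiners_def)
  have disj: "intertwiners n A B \<inter> intertwiners n A' B = {}"
    if A: "A \<in> carrier_mat n n" and A': "A' \<in> carrier_mat n n" and "A \<noteq> A'" for A A'
  proof (rule ccontr)
    assume "intertwiners n A B \<inter> intertwiners n A' B \<noteq> {}"
    then obtain P where P: "P \<in> GL_mat n" "A * P = P * B" "A' * P = P * B"
      unfolding intertwiners_def by blast
    then obtain Q where Pc: "P \<in> carrier_mat n n" and Q: "Q \<in> carrier_mat n n" "P * Q = 1\<^sub>m n"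
      by (auto simp: GL_mat_iff_inverse)
    have "A * P = A' * P" using P by simp
    from arg_cong[OF this, of "\<lambda>X. X * Q"] have "A * (P * Q) = A' * (P * Q)"
      using A A' Pc Q(1) by (simp add: assoc_mult_mat[of _ n n _ n _ n])
    then show False using \<open>A \<noteq> A'\<close> A A' Q by simp
  qed
  have "gl_order TYPE('a) n = (\<Sum>A\<in>?O. card (intertwiners n A B))"
    unfolding gl_order_def GL using disj
    by (intro card_UN_disjoint fin) (auto intro: finite_intertwiners)
  also have "\<dots> = (\<Sum>A\<in>?O. card (intertwiners n B B))"
    using B by (intro sum.cong refl card_intertwiners) auto
  finally show ?thesis by simp
qed

section \<open>Diagonal matrices up to similarity\<close>

definition list_diag :: "'a::field list \<Rightarrow> 'a mat" where
  "list_diag xs = mat_diag (length xs) (\<lambda>i. xs ! i)"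

lemma list_diag_carrier: "length xs = n \<Longrightarrow> list_diag xs \<in> carrier_mat n n"
  by (auto simp: list_diag_def)

lemma intertwiners_list_diag:
  assumes "length xs = n" "length ys = n"
  shows "intertwiners n (list_diag xs) (list_diag ys) =
    {P \<in> GL_mat n. \<forall>i<n. \<forall>j<n. P $$ (i,j) \<noteq> 0 \<longrightarrow> xs ! i = ys ! j}"
proof -
  have "list_diag xs * P = P * list_diag ys \<longleftrightarrow>
      (\<forall>i<n. \<forall>j<n. P $$ (i,j) \<noteq> 0 \<longrightarrow> xs ! i = ys ! j)" if "P \<in> carrier_mat n n" for P
    using that assms unfolding list_diag_def
    by (auto simp: mat_diag_mult_left[of _ n n] mat_diag_mult_right[of _ n n] mat_eq_iff)
  then show ?thesis by (auto simp: intertwiners_def GL_mat_carrier)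
qed

text \<open>
  If \<open>P\<close> is an invertible intertwiner, some term of the Leibniz expansion of \<open>det P\<close> is nonzero, so
  there is a permutation \<open>p\<close> with \<open>P\<^bsub>i,p i\<^esub> \<noteq> 0\<close> for all \<open>i\<close>, and \<open>p\<close> carries one diagonal to the
  other. Conversely, a permutation matrix conjugates a diagonal matrix into its rearrangement.
\<close>

lemma similar_list_diag_iff:
  fixes xs ys :: "'a::field list"
  assumes len: "length xs = n" "length ys = n"
  shows "similar_mat (list_diag xs) (list_diag ys) \<longleftrightarrow> mset xs = mset ys"
proof
  assume "similar_mat (list_diag xs) (list_diag ys)"
  then obtain P where "P \<in> intertwiners n (list_diag xs) (list_diag ys)"
    using similar_mat_iff_intertwiners[OF list_diag_carrier list_diag_carrier, OF len] by auto
  then have P: "P \<in> GL_mat n"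
    and eq: "\<And>i j. i < n \<Longrightarrow> j < n \<Longrightarrow> P $$ (i,j) \<noteq> 0 \<Longrightarrow> xs ! i = ys ! j"
    by (auto simp: intertwiners_list_diag[OF len])
  have Pc: "P \<in> carrier_mat n n" and "det P \<noteq> 0" using P by (auto simp: GL_mat_iff_det)
  then have "(\<Sum>p\<in>{p. p permutes {0..<n}}. signof p * (\<Prod>i=0..<n. P $$ (i, p i))) \<noteq> 0"
    by (simp add: det_def'[OF Pc])
  then obtain p where p: "p permutes {0..<n}" "(\<Prod>i=0..<n. P $$ (i, p i)) \<noteq> 0"
    by (metis (mono_tags, lifting) mem_Collect_eq mult_zero_right sum.neutral)
  have p': "p permutes {..<length ys}" using p(1) len by (simp add: lessThan_atLeast0)
  have "xs = permute_list p ys"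
  proof (rule nth_equalityI)
    fix i assume "i < length xs"
    then have i: "i < n" using len by simp
    then have "p i < n" using permutes_in_image[OF p(1), of i] by simp
    moreover have "P $$ (i, p i) \<noteq> 0" using p(2) i by simp
    ultimately show "xs ! i = permute_list p ys ! i"
      using eq i len by (simp add: permute_list_nth[OF p'])
  qed (use len in simp)
  then show "mset xs = mset ys" using p' by simp
next
  assume "mset xs = mset ys"
  then obtain p where p: "p permutes {..<length ys}" "permute_list p ys = xs"
    by (rule mset_eq_permutation)
  have p': "p permutes {0..<n}" using p(1) len by (simp add: lessThan_atLeast0)
  have lt: "p i < n" if "i < n" for i using permutes_in_image[OF p', of i] that by simp
  let ?P = "mat n n (\<lambda>(i,j). 1\<^sub>m n $$ (p i, j)) :: 'a mat"
  have "det ?P = signof p" using det_permute_rows[OF one_carrier_mat p', where 'a = 'a] by simp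
  then have GL: "?P \<in> GL_mat n" by (auto simp: GL_mat_iff_det sign_def)
  have "xs ! i = ys ! j" if "i < n" "j < n" "?P $$ (i,j) \<noteq> 0" for i j
    using that lt[of i] len permute_list_nth[OF p(1), of i] p(2) by (auto split: if_splits)
  then have "?P \<in> intertwiners n (list_diag xs) (list_diag ys)"
    using GL by (auto simp: intertwiners_list_diag[OF len])
  then show "similar_mat (list_diag xs) (list_diag ys)"
    using similar_mat_iff_intertwiners[OF list_diag_carrier list_diag_carrier, OF len] by auto
qed

lemma diagonalizable_mat_iff_list_diag:
  assumes A: "A \<in> carrier_mat n n"
  shows "diagonalizable_mat A \<longleftrightarrow> (\<exists>xs. length xs = n \<and> similar_mat A (list_diag xs))"
proof
  assume "diagonalizable_mat A"
  then obtain D where D: "diagonal_mat D" "similar_mat A D" by (auto simp: diagonalizable_mat_def)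
  then have Dc: "D \<in> carrier_mat n n" using similar_matD[OF D(2)] A by auto
  have "D = list_diag (map (\<lambda>i. D $$ (i,i)) [0..<n])"
    using D(1) Dc by (intro eq_matI) (auto simp: list_diag_def mat_diag_def diagonal_mat_def)
  then show "\<exists>xs. length xs = n \<and> similar_mat A (list_diag xs)"
    using D(2) by (intro exI[of _ "map (\<lambda>i. D $$ (i,i)) [0..<n]"]) simp
next
  assume "\<exists>xs. length xs = n \<and> similar_mat A (list_diag xs)"
  moreover have "diagonal_mat (list_diag xs)" for xs :: "'a list"
    by (auto simp: diagonal_mat_def list_diag_def mat_diag_def)
  ultimately show "diagonalizable_mat A" by (auto simp: diagonalizable_mat_def)
qed

section \<open>Centralizers of diagonal matrices\<close>

text \<open>
  An entry of a commuting matrix whose row and column belong to different diagonal values vanishes,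
  so commuting matrices split into blocks along diagonals without common value.
\<close>

lemma card_centralizer_append:
  fixes xs ys :: "'a::field list"
  assumes disj: "set xs \<inter> set ys = {}" and len: "length xs = k" "length ys = m"
  shows "card (intertwiners (k + m) (list_diag (xs @ ys)) (list_diag (xs @ ys))) =
    card (intertwiners k (list_diag xs) (list_diag xs)) *
    card (intertwiners m (list_diag ys) (list_diag ys))" (is "card ?C = card ?Cx * card ?Cy")
proof -
  have len': "length (xs @ ys) = k + m" using len by simp
  note I = intertwiners_list_diag[OF len' len'] intertwiners_list_diag[OF len(1) len(1)]
    intertwiners_list_diag[OF len(2) len(2)]
  let ?f = "\<lambda>(X, Y). four_block_mat X (0\<^sub>m k m) (0\<^sub>m m k) Y"
  have det: "det (four_block_mat X (0\<^sub>m k m) (0\<^sub>m m k) Y) = det X * det Y"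
    if "X \<in> carrier_mat k k" "Y \<in> carrier_mat m m" for X Y :: "'a mat"
    using that by (intro det_four_block_mat_upper_right_zero) auto
  have "inj_on ?f (?Cx \<times> ?Cy)"
  proof (rule inj_onI, clarify)
    fix X Y X' Y'
    assume m: "X \<in> ?Cx" "Y \<in> ?Cy" "X' \<in> ?Cx" "Y' \<in> ?Cy"
      and eq: "four_block_mat X (0\<^sub>m k m) (0\<^sub>m m k) Y = four_block_mat X' (0\<^sub>m k m) (0\<^sub>m m k) Y'"
    have c: "X \<in> carrier_mat k k" "Y \<in> carrier_mat m m" "X' \<in> carrier_mat k k" "Y' \<in> carrier_mat m m"
      using m by (auto simp: intertwiners_def GL_mat_carrier)
    have "X $$ (i,j) = X' $$ (i,j)" if "i < k" "j < k" for i j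
      using arg_cong[OF eq, of "\<lambda>M. M $$ (i,j)"] that c by simp
    moreover have "Y $$ (i,j) = Y' $$ (i,j)" if "i < m" "j < m" for i j
      using arg_cong[OF eq, of "\<lambda>M. M $$ (k+i,k+j)"] that c by simp
    ultimately show "X = X' \<and> Y = Y'" using c by (auto intro!: eq_matI)
  qed
  moreover have "?f ` (?Cx \<times> ?Cy) = ?C"
  proof (intro equalityI subsetI)
    fix M assume "M \<in> ?f ` (?Cx \<times> ?Cy)"
    then obtain X Y where XY: "X \<in> ?Cx" "Y \<in> ?Cy"
      and M: "M = four_block_mat X (0\<^sub>m k m) (0\<^sub>m m k) Y" by auto
    have c: "X \<in> carrier_mat k k" "Y \<in> carrier_mat m m" "det X \<noteq> 0" "det Y \<noteq> 0"
      using XY by (auto simp: intertwiners_def GL_mat_iff_det)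
    have "M \<in> GL_mat (k + m)" using c by (auto simp: M GL_mat_iff_det det)
    moreover have "(xs @ ys) ! i = (xs @ ys) ! j"
      if "i < k + m" "j < k + m" "M $$ (i,j) \<noteq> 0" for i j
      using that XY c len by (auto simp: M I nth_append split: if_splits)
    ultimately show "M \<in> ?C" by (auto simp: I)
  next
    fix M assume "M \<in> ?C"
    then have GL: "M \<in> GL_mat (k + m)" and eq: "\<And>i j. i < k + m \<Longrightarrow> j < k + m \<Longrightarrow>
      M $$ (i,j) \<noteq> 0 \<Longrightarrow> (xs @ ys) ! i = (xs @ ys) ! j" by (auto simp: I)
    have Mc: "M \<in> carrier_mat (k + m) (k + m)" using GL by (rule GL_mat_carrier)
    define X where "X = mat k k (\<lambda>(i,j). M $$ (i,j))"
    define Y where "Y = mat m m (\<lambda>(i,j). M $$ (k + i,k + j))"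
    have ne: "xs ! i \<noteq> ys ! j" if "i < k" "j < m" for i j
      using that disj len by (metis disjoint_iff nth_mem)
    have z1: "M $$ (i, k + j) = 0" if "i < k" "j < m" for i j
      using eq[of i "k + j"] ne[OF that] that len by (auto simp: nth_append)
    have z2: "M $$ (k + j, i) = 0" if "i < k" "j < m" for i j
      using eq[of "k + j" i] ne[OF that] that len by (auto simp: nth_append)
    have M: "M = four_block_mat X (0\<^sub>m k m) (0\<^sub>m m k) Y"
    proof (rule eq_matI)
      fix i j assume "i < dim_row (four_block_mat X (0\<^sub>m k m) (0\<^sub>m m k) Y)"
        "j < dim_col (four_block_mat X (0\<^sub>m k m) (0\<^sub>m m k) Y)"
      then have ij: "i < k + m" "j < k + m" by (auto simp: X_def Y_def)
      then show "M $$ (i,j) = four_block_mat X (0\<^sub>m k m) (0\<^sub>m m k) Y $$ (i,j)"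
        using z1[of i "j - k"] z2[of j "i - k"] by (auto simp: X_def Y_def)
    qed (use Mc in \<open>auto simp: X_def Y_def\<close>)
    have c: "X \<in> carrier_mat k k" "Y \<in> carrier_mat m m" by (auto simp: X_def Y_def)
    have "det X \<noteq> 0" "det Y \<noteq> 0" using GL det[OF c] by (auto simp: M GL_mat_iff_det)
    moreover have "xs ! i = xs ! j" if "i < k" "j < k" "X $$ (i,j) \<noteq> 0" for i j
      using eq[of i j] that len by (auto simp: X_def nth_append)
    moreover have "ys ! i = ys ! j" if "i < m" "j < m" "Y $$ (i,j) \<noteq> 0" for i j
      using eq[of "k + i" "k + j"] that len by (auto simp: Y_def nth_append)
    ultimately have "X \<in> ?Cx" "Y \<in> ?Cy" using c by (auto simp: I GL_mat_iff_det)
    then show "M \<in> ?f ` (?Cx \<times> ?Cy)" using M by (intro image_eqI[of _ _ "(X, Y)"]) auto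
  qed
  ultimately have "card ?C = card (?Cx \<times> ?Cy)" by (metis card_image)
  then show ?thesis by (simp add: card_cartesian_product)
qed

text \<open>
  The diagonal chosen to represent a similarity class. Equal entries are contiguous, so that the
  centralizer splits off one block per eigenvalue.
\<close>

definition eigenvalue_list :: "nat list \<Rightarrow> 'a list \<Rightarrow> 'a list" where
  "eigenvalue_list ns as = concat (map2 replicate ns as)"

lemma eigenvalue_list_Nil [simp]: "eigenvalue_list [] [] = []"
  by (simp add: eigenvalue_list_def)

lemma eigenvalue_list_Cons [simp]:
  "eigenvalue_list (k # ns) (a # as) = replicate k a @ eigenvalue_list ns as"
  by (simp add: eigenvalue_list_def)

lemma length_eigenvalue_list:
  "length ns = length as \<Longrightarrow> length (eigenvalue_list ns as) = sum_list ns"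
  by (induction ns as rule: list_induct2) auto

lemma set_eigenvalue_list: "length ns = length as \<Longrightarrow> set (eigenvalue_list ns as) \<subseteq> set as"
  by (induction ns as rule: list_induct2) auto

lemma count_eigenvalue_list:
  "length ns = length as \<Longrightarrow> distinct as \<Longrightarrow> i < length as \<Longrightarrow>
    count (mset (eigenvalue_list ns as)) (as ! i) = ns ! i"
proof (induction ns as arbitrary: i rule: list_induct2)
  case (Cons k ns a as)
  have "a \<notin> set (eigenvalue_list ns as)"
    using set_eigenvalue_list[OF Cons.hyps] Cons.prems by auto
  then show ?case using Cons by (cases i) (auto simp: nth_eq_iff_index_eq)
qed simp

lemma card_centralizer_eigenvalue_list:
  fixes as :: "'a::{field,finite} list"
  assumes "length ns = length as" "distinct as" "sum_list ns = n"
  shows "card (intertwiners n (list_diag (eigenvalue_list ns as)) (list_diag (eigenvalue_list ns as)))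
    = (\<Prod>i<length as. gl_order TYPE('a) (ns ! i))"
  using assms
proof (induction ns as arbitrary: n rule: list_induct2)
  case Nil
  have "intertwiners 0 (list_diag []) (list_diag []) = (GL_mat 0 :: 'a mat set)"
    by (simp add: intertwiners_list_diag)
  then show ?case using Nil gl_order_0[where 'a = 'a] by (simp add: gl_order_def)
next
  case (Cons k ns a as)
  let ?e = "eigenvalue_list ns as" and ?r = "replicate k a"
  have n: "n = k + sum_list ns" using Cons.prems by simp
  have "set ?r \<inter> set ?e = {}" using set_eigenvalue_list[OF Cons.hyps] Cons.prems by auto
  then have "card (intertwiners n (list_diag (?r @ ?e)) (list_diag (?r @ ?e))) =
      card (intertwiners k (list_diag ?r) (list_diag ?r)) *
      card (intertwiners (sum_list ns) (list_diag ?e) (list_diag ?e))"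
    unfolding n by (rule card_centralizer_append) (simp_all add: length_eigenvalue_list Cons.hyps)
  also have "intertwiners k (list_diag ?r) (list_diag ?r) = GL_mat k"
    by (auto simp: intertwiners_list_diag)
  also have "card (intertwiners (sum_list ns) (list_diag ?e) (list_diag ?e)) =
      (\<Prod>i<length as. gl_order TYPE('a) (ns ! i))"
    using Cons by simp
  finally show ?case by (simp add: gl_order_def prod.lessThan_Suc_shift del: prod.lessThan_Suc)
qed

section \<open>Counting diagonalizable matrices\<close>

lemma finite_natpermute_set: "finite {ns :: nat list. length ns = q \<and> sum_list ns = n}"
  using natpermute_finite[of n q] by (simp add: natpermute_def)

text \<open>
  The similarity classes of diagonalizable matrices are indexed without repetition by the tuples of
  multiplicities, because the multiset of diagonal entries is a complete invariant. The list \<open>as\<close>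
  fixes the order in which the multiplicities of the field elements are listed.
\<close>

lemma num_diagonalizable_eq:
  fixes as :: "'a::{field,finite} list"
  assumes as: "distinct as" "set as = UNIV"
  shows "(of_nat (num_diagonalizable TYPE('a) n) :: rat) =
    (\<Sum>ns | length ns = length as \<and> sum_list ns = n.
      of_nat (gl_order TYPE('a) n) / (\<Prod>i<length as. of_nat (gl_order TYPE('a) (ns ! i))))"
proof -
  let ?T = "{ns. length ns = length as \<and> sum_list ns = n}"
  let ?D = "\<lambda>ns. list_diag (eigenvalue_list ns as)"
  let ?O = "\<lambda>ns. {A \<in> carrier_mat n n. similar_mat A (?D ns)}"
  have Dc: "?D ns \<in> carrier_mat n n" if "ns \<in> ?T" for ns
    using that by (intro list_diag_carrier) (simp add: length_eigenvalue_list)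
  have "{A :: 'a mat. A \<in> carrier_mat n n \<and> diagonalizable_mat A} = (\<Union>ns\<in>?T. ?O ns)"
  proof (intro equalityI subsetI)
    fix A :: "'a mat" assume "A \<in> {A. A \<in> carrier_mat n n \<and> diagonalizable_mat A}"
    then obtain xs where A: "A \<in> carrier_mat n n" and xs: "length xs = n" "similar_mat A (list_diag xs)"
      using diagonalizable_mat_iff_list_diag by blast
    \<comment> \<open>Sorting the diagonal does not leave the similarity class.\<close>
    let ?ns = "map (count_list xs) as"
    have "mset (eigenvalue_list ?ns as) = mset xs"
    proof (rule multiset_eqI)
      fix x
      obtain i where i: "i < length as" "x = as ! i" using as(2) by (metis UNIV_I in_set_conv_nth)
      then show "count (mset (eigenvalue_list ?ns as)) x = count (mset xs) x"
        using count_eigenvalue_list[of ?ns as i] as(1) by (simp add: count_mset)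
    qed
    moreover from this have len: "length (eigenvalue_list ?ns as) = n"
      using xs(1) by (metis size_mset)
    ultimately have "similar_mat (list_diag xs) (?D ?ns)"
      using xs(1) by (subst similar_list_diag_iff[of _ n]) auto
    then have "A \<in> ?O ?ns" using A xs(2) similar_mat_trans by blast
    moreover have "?ns \<in> ?T" using len by (simp add: length_eigenvalue_list)
    ultimately show "A \<in> (\<Union>ns\<in>?T. ?O ns)" by blast
  next
    fix A assume "A \<in> (\<Union>ns\<in>?T. ?O ns)"
    then obtain ns where "ns \<in> ?T" "A \<in> ?O ns" by blast
    then show "A \<in> {A. A \<in> carrier_mat n n \<and> diagonalizable_mat A}"
      by (auto simp: diagonalizable_mat_iff_list_diag[of _ n] length_eigenvalue_list
          intro!: exI[of _ "eigenvalue_list ns as"])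
  qed
  moreover have fin_O: "finite (?O ns)" for ns
    by (rule finite_subset[OF _ finite_carrier_mat[of n n]]) auto
  moreover have "?O ns \<inter> ?O ms = {}" if ns: "ns \<in> ?T" and ms: "ms \<in> ?T" and "ns \<noteq> ms" for ns ms
  proof (rule ccontr)
    assume "?O ns \<inter> ?O ms \<noteq> {}"
    then have "similar_mat (?D ns) (?D ms)" using similar_mat_sym similar_mat_trans by blast
    then have eq: "mset (eigenvalue_list ns as) = mset (eigenvalue_list ms as)"
      using ns ms by (subst (asm) similar_list_diag_iff[of _ n]) (auto simp: length_eigenvalue_list)
    have "ns ! i = ms ! i" if "i < length as" for i
      using that eq count_eigenvalue_list[of ns as i] count_eigenvalue_list[of ms as i] ns ms as(1)
      by simp
    then have "ns = ms" using ns ms by (intro nth_equalityI) auto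
    then show False using \<open>ns \<noteq> ms\<close> by simp
  qed
  ultimately have "num_diagonalizable TYPE('a) n = (\<Sum>ns\<in>?T. card (?O ns))"
    unfolding num_diagonalizable_def using fin_O
    by (simp only:) (intro card_UN_disjoint finite_natpermute_set; blast)
  moreover have "(of_nat (card (?O ns)) :: rat) =
      of_nat (gl_order TYPE('a) n) / (\<Prod>i<length as. of_nat (gl_order TYPE('a) (ns ! i)))"
    if ns: "ns \<in> ?T" for ns
  proof -
    let ?p = "\<Prod>i<length as. gl_order TYPE('a) (ns ! i)"
    have "card (?O ns) * ?p = gl_order TYPE('a) n"
      using card_similarity_class[OF Dc[OF ns]] card_centralizer_eigenvalue_list[of ns as n] ns as(1)
      by simp
    then have "(of_nat (card (?O ns)) :: rat) * of_nat ?p = of_nat (gl_order TYPE('a) n)"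
      by (metis of_nat_mult)
    moreover have "(of_nat ?p :: rat) \<noteq> 0"
      unfolding of_nat_eq_0_iff by (simp add: gl_order_pos[THEN less_imp_neq, THEN not_sym])
    ultimately show ?thesis by (simp add: nonzero_eq_divide_eq)
  qed
  ultimately show ?thesis by (simp del: of_nat_prod)
qed

theorem theorem13:
  fixes q :: nat and d \<gamma> :: "nat \<Rightarrow> nat"
  assumes "primepow q"
    and "card (UNIV :: 'a::{field,finite} set) = q"
  defines "\<gamma> \<equiv> gl_order TYPE('a)"
    and "d \<equiv> num_diagonalizable TYPE('a)"
  shows "1 + Abs_fps (\<lambda>n. if n \<ge> 1 then of_nat (d n) / of_nat (\<gamma> n) else 0)
           = (Abs_fps (\<lambda>m. 1 / of_nat (\<gamma> m)) :: rat fps) ^ q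
    \<and> (\<forall>n\<ge>1. (of_nat (d n) :: rat) =
           (\<Sum>ns | length ns = q \<and> sum_list ns = n.
              of_nat (\<gamma> n) / (\<Prod>i<q. of_nat (\<gamma> (ns ! i)))))"
proof -
  obtain as :: "'a list" where as: "distinct as" "set as = UNIV"
    using finite_distinct_list[OF finite_class.finite_UNIV] by blast
  have q: "length as = q" using as assms(2) distinct_card by metis
  have "q > 0" using q as(2) by (cases as) auto
  have d: "(of_nat (d n) :: rat) =
      (\<Sum>ns | length ns = q \<and> sum_list ns = n. of_nat (\<gamma> n) / (\<Prod>i<q. of_nat (\<gamma> (ns ! i))))" for n
    using num_diagonalizable_eq[OF as] q by (simp add: d_def \<gamma>_def)
  have "1 + Abs_fps (\<lambda>n. if n \<ge> 1 then of_nat (d n) / of_nat (\<gamma> n) else 0)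
      = (Abs_fps (\<lambda>m. 1 / of_nat (\<gamma> m)) :: rat fps) ^ q" (is "?L = ?G ^ q")
  proof (rule fps_ext)
    fix n
    show "fps_nth ?L n = fps_nth (?G ^ q) n"
    proof (cases "n = 0")
      case True
      then show ?thesis by (simp add: fps_power_zeroth \<gamma>_def gl_order_0)
    next
      case False
      have \<gamma>n: "(of_nat (\<gamma> n) :: rat) \<noteq> 0"
        unfolding \<gamma>_def of_nat_eq_0_iff by (metis gl_order_pos less_numeral_extra(3))
      have "fps_nth ?L n = of_nat (d n) / of_nat (\<gamma> n)" using False by simp
      also have "\<dots> = (\<Sum>ns | length ns = q \<and> sum_list ns = n. \<Prod>i<q. 1 / of_nat (\<gamma> (ns ! i)))"
        unfolding d sum_divide_distrib using \<gamma>n by (simp add: prod_dividef)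
      also have "\<dots> = fps_nth (?G ^ q) n"
      proof -
        have "{0..q - 1} = {..<q}" using \<open>q > 0\<close> by auto
        then show ?thesis using \<open>q > 0\<close> by (simp add: fps_power_nth natpermute_def)
      qed
      finally show ?thesis .
    qed
  qed
  then show ?thesis using d by blast
qed

end
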